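(* Let $(\mathcal T,d)$ be a duality triangulation, with finitely many simplices, of a connected $n$-dimensional manifold. If $|\bigstar\{i,j\}|>0$ for all edges $\{i,j\}\in\mathcal T_1$, then the Laplacian matrix $L$ is negative semidefinite with nullspace spanned by the constant vectors.
   Context: $\mathcal T_k$ denotes the set of $k$-simplices of a triangulation $\mathcal T$. A duality triangulation $(\mathcal T,d)$ of an $n$-dimensional manifold is a real function $d$ on directed edges with $d_{ij}^2+d_{jk}^2+d_{ki}^2=d_{ji}^2+d_{ik}^2+d_{kj}^2$ for each $\{i,j,k\}\in\mathcal T_2$ and such that the lengths $\ell_{ij}=d_{ij}+d_{ji}>0$ make every simplex a nondegenerate Euclidean simplex. Each simplex $\sigma$ has a center $C(\sigma)$ in the affine span of its Euclidean realization: $C(\{i\})=i$, $C(\{i,j\})$ is the point of the line through $i,j$ at signed distance $d_{ij}$ from $i$ in the direction of $j$, and $C(\sigma^m)$ is the unique point lying on all the hyperplanes (of the $m$-dimensional span of $\sigma^m$) through $C(\{i,j\})$ perpendicular to $\{i,j\}$, for edges $\{i,j\}$ of $\sigma^m$. For $\sigma^{j}\subset\sigma^{j+1}$, the signed distance $d_\pm[C(\sigma^j),C(\sigma^{j+1})]$ is the Euclidean distance in the span of $\sigma^{j+1}$, with positive sign if $C(\sigma^{j+1})$ is on the same side of the hyperplane spanned by $\sigma^j$ as $\sigma^{j+1}$ and negative sign otherwise. The signed dual volume is $$|\bigstar\sigma^k|=\frac1{(n-k)!}\sum_{\sigma^k\subset\sigma^{k+1}\subset\cdots\subset\sigma^n}\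 \prod_{j=k}^{n-1}d_\pm[C(\sigma^j),C(\sigma^{j+1})],$$ the sum being over all strings of simplices of $\mathcal T$ starting at the given $\sigma^k$ (and $|\bigstar\sigma^n|=1$). We write $|\{i,j\}|=\ell_{ij}$. The matrix $L$, indexed by the vertices $\mathcal T_0$, has $L_{ij}=\frac{|\bigstar\{i,j\}|}{|\{i,j\}|}$ for $\{i,j\}\in\mathcal T_1$, $L_{ij}=0$ for $i\ne j$ with $\{i,j\}\notin\mathcal T_1$, and $L_{ii}=-\sum_{j:\{i,j\}\in\mathcal T_1}\frac{|\bigstar\{i,j\}|}{|\{i,j\}|}$. *)

theory Defs
  imports "HOL-Analysis.Analysis"
begin

definition n_manifold :: "nat \<Rightarrow> 'm topology \<Rightarrow> bool" where
  "n_manifold n M \<longleftrightarrow>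
     Hausdorff_space M \<and> second_countable M \<and>
     (\<forall>x\<in>topspace M. \<exists>U W. openin M U \<and> x \<in> U \<and> openin (Euclidean_space n) W \<and>
        subtopology M U homeomorphic_space subtopology (Euclidean_space n) W)"

text \<open>An abstract simplicial complex is the set of the vertex sets of its (nonempty) simplices.
  All vertices come from a type of class \<open>finite\<close>, so that matrices and
  vectors indexed by vertices are those of the library.\<close>

definition abstract_complex :: "'v::finite set set \<Rightarrow> bool" where
  "abstract_complex T \<longleftrightarrow> {} \<notin> T \<and> (\<forall>\<sigma>\<in>T. \<forall>\<rho>. \<rho> \<subseteq> \<sigma> \<and> \<rho> \<noteq> {} \<longrightarrow> \<rho> \<in> T)"

definition simplices :: "'v::finite set set \<Rightarrow> nat \<Rightarrow> 'v set set" where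
  "simplices T k = {\<sigma>\<in>T. card \<sigma> = k + 1}"

definition geometric_realization :: "'v::finite set set \<Rightarrow> (real^'v) set" where
  "geometric_realization T = (\<Union>\<sigma>\<in>T. convex hull ((\<lambda>i. axis i 1) ` \<sigma>))"

definition triangulates :: "'v::finite set set \<Rightarrow> 'm topology \<Rightarrow> bool" where
  "triangulates T M \<longleftrightarrow>
     abstract_complex T \<and> top_of_set (geometric_realization T) homeomorphic_space M"

text \<open>The number \<open>d i j\<close> is meaningful only if \<open>{i, j}\<close> is an edge.\<close>

definition edge_length :: "('v \<Rightarrow> 'v \<Rightarrow> real) \<Rightarrow> 'v \<Rightarrow> 'v \<Rightarrow> real" where
  "edge_length d i j = d i j + d j i"

text \<open>Placement of a simplex as a nondegenerate Euclidean simplex with the prescribed edge lengths.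
  The ambient space \<open>real^'v\<close> has room for a nondegenerate simplex on any set of vertices.\<close>

definition Euclidean_placement ::
    "('v::finite \<Rightarrow> 'v \<Rightarrow> real) \<Rightarrow> 'v set \<Rightarrow> ('v \<Rightarrow> real^'v) \<Rightarrow> bool" where
  "Euclidean_placement d \<sigma> p \<longleftrightarrow>
     inj_on p \<sigma> \<and> \<not> affine_dependent (p ` \<sigma>) \<and>
     (\<forall>i\<in>\<sigma>. \<forall>j\<in>\<sigma>. i \<noteq> j \<longrightarrow> dist (p i) (p j) = edge_length d i j)"

definition duality_structure :: "'v::finite set set \<Rightarrow> ('v \<Rightarrow> 'v \<Rightarrow> real) \<Rightarrow> bool" where
  "duality_structure T d \<longleftrightarrow>
     (\<forall>i j k. {i, j, k} \<in> simplices T 2 \<longrightarrow>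
        (d i j)\<^sup>2 + (d j k)\<^sup>2 + (d k i)\<^sup>2 = (d j i)\<^sup>2 + (d i k)\<^sup>2 + (d k j)\<^sup>2) \<and>
     (\<forall>i j. {i, j} \<in> simplices T 1 \<longrightarrow> edge_length d i j > 0) \<and>
     (\<forall>\<sigma>\<in>T. \<exists>p. Euclidean_placement d \<sigma> p)"

text \<open>The choice of the placement is immaterial: any two placements of the same simplex differ by
  an isometry.\<close>

definition placement :: "('v::finite \<Rightarrow> 'v \<Rightarrow> real) \<Rightarrow> 'v set \<Rightarrow> 'v \<Rightarrow> real^'v" where
  "placement d \<sigma> = (SOME p. Euclidean_placement d \<sigma> p)"

definition edge_center ::
    "('v::finite \<Rightarrow> 'v \<Rightarrow> real) \<Rightarrow> ('v \<Rightarrow> real^'v) \<Rightarrow> 'v \<Rightarrow> 'v \<Rightarrow> real^'v" where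
  "edge_center d p i j = p i + d i j *\<^sub>R sgn (p j - p i)"

text \<open>Center of \<open>\<sigma>\<close> with respect to a placement \<open>p\<close> of \<open>\<sigma>\<close> or of a larger simplex.  The cases of
  vertices and edges are included in the general formula; see the two lemmas below.\<close>

definition center ::
    "('v::finite \<Rightarrow> 'v \<Rightarrow> real) \<Rightarrow> ('v \<Rightarrow> real^'v) \<Rightarrow> 'v set \<Rightarrow> real^'v" where
  "center d p \<sigma> = (THE c. c \<in> affine hull (p ` \<sigma>) \<and>
     (\<forall>i\<in>\<sigma>. \<forall>j\<in>\<sigma>. i \<noteq> j \<longrightarrow> (c - edge_center d p i j) \<bullet> (p j - p i) = 0))"

lemma center_vertex: "center d p {i} = p i"
  unfolding center_def by auto

lemma center_edge:
  assumes "p i \<noteq> p j" and "dist (p i) (p j) = edge_length d i j"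
  shows "center d p {i, j} = edge_center d p i j"
proof -
  let ?w = "p j - p i" and ?l = "edge_length d i j"
  have l: "norm ?w = ?l" "?l > 0"
    using assms zero_less_dist_iff[of "p i" "p j"] by (simp_all add: dist_norm norm_minus_commute)
  have ww: "?w \<bullet> ?w = ?l * ?l" by (metis l(1) power2_norm_eq_inner power2_eq_square)
  have ij: "i \<noteq> j" using assms(1) by auto
  have c1: "edge_center d p i j = p i + (d i j / ?l) *\<^sub>R ?w"
    by (simp add: edge_center_def sgn_div_norm l(1) divide_inverse)
  have "edge_center d p j i = p j + (d j i / ?l) *\<^sub>R (p i - p j)"
    using l(1) by (simp add: edge_center_def sgn_div_norm divide_inverse norm_minus_commute)
  also have "\<dots> = p i + (1 - d j i / ?l) *\<^sub>R ?w" by (simp add: algebra_simps)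
  also have "1 - d j i / ?l = d i j / ?l"
    using l(2) by (simp add: edge_length_def field_simps)
  finally have c2: "edge_center d p j i = edge_center d p i j" using c1 by simp
  show ?thesis unfolding center_def
  proof (rule the_equality, intro conjI)
    have "edge_center d p i j = (1 - d i j / ?l) *\<^sub>R p i + (d i j / ?l) *\<^sub>R p j"
      unfolding c1 by (simp add: algebra_simps)
    then show "edge_center d p i j \<in> affine hull (p ` {i, j})"
      by (simp add: affine_hull_2) (metis diff_add_cancel)
    show "\<forall>a\<in>{i, j}. \<forall>b\<in>{i, j}. a \<noteq> b \<longrightarrow>
        (edge_center d p i j - edge_center d p a b) \<bullet> (p b - p a) = 0"
      using c2 by auto
  next
    fix c
    assume c: "c \<in> affine hull (p ` {i, j}) \<and> (\<forall>a\<in>{i, j}. \<forall>b\<in>{i, j}. a \<noteq> b \<longrightarrow>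
        (c - edge_center d p a b) \<bullet> (p b - p a) = 0)"
    then obtain u v where uv: "c = u *\<^sub>R p i + v *\<^sub>R p j" "u + v = 1"
      by (auto simp: affine_hull_2)
    have u: "u = 1 - v" using uv(2) by simp
    have cv: "c = p i + v *\<^sub>R ?w" unfolding uv(1) u by (simp add: algebra_simps)
    have "(c - edge_center d p i j) \<bullet> ?w = 0" using c ij by auto
    then have "(v - d i j / ?l) * (?w \<bullet> ?w) = 0"
      unfolding cv c1 by (simp add: inner_left_distrib inner_diff_left left_diff_distrib)
    then have "v = d i j / ?l" using ww l(2) by auto
    then show "c = edge_center d p i j" using cv c1 by simp
  qed
qed

text \<open>The side of the hyperplane spanned by the facet \<open>\<sigma>\<close> of \<open>\<tau>\<close> on which \<open>\<tau>\<close> lies is that of the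
  opposite vertex.  If the center of \<open>\<tau>\<close> lies on this hyperplane, it is the center of \<open>\<sigma>\<close>, and
  the signed distance is 0.\<close>

definition signed_dist :: "('v::finite \<Rightarrow> 'v \<Rightarrow> real) \<Rightarrow> 'v set \<Rightarrow> 'v set \<Rightarrow> real" where
  "signed_dist d \<sigma> \<tau> =
     (let p = placement d \<tau>; r = dist (center d p \<sigma>) (center d p \<tau>) in
      if \<forall>v\<in>\<tau> - \<sigma>. closed_segment (center d p \<tau>) (p v) \<inter> affine hull (p ` \<sigma>) = {}
      then r else - r)"

text \<open>Strings of simplices of consecutive dimensions \<open>k, \<dots>, n\<close> starting at the \<open>k\<close>-simplex \<open>\<sigma>\<close>.\<close>

definition strings :: "'v::finite set set \<Rightarrow> nat \<Rightarrow> nat \<Rightarrow> 'v set \<Rightarrow> 'v set list set" where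
  "strings T n k \<sigma> = {s. length s = n - k + 1 \<and> s ! 0 = \<sigma> \<and>
     (\<forall>m\<le>n - k. s ! m \<in> simplices T (k + m)) \<and> (\<forall>m<n - k. s ! m \<subset> s ! Suc m)}"

definition dual_volume ::
    "'v::finite set set \<Rightarrow> ('v \<Rightarrow> 'v \<Rightarrow> real) \<Rightarrow> nat \<Rightarrow> 'v set \<Rightarrow> real" where
  "dual_volume T d n \<sigma> = (let k = card \<sigma> - 1 in
     1 / fact (n - k) *
     (\<Sum>s\<in>strings T n k \<sigma>. \<Prod>m<n - k. signed_dist d (s ! m) (s ! Suc m)))"

definition laplacian ::
    "'v::finite set set \<Rightarrow> ('v \<Rightarrow> 'v \<Rightarrow> real) \<Rightarrow> nat \<Rightarrow> real^'v^'v" where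
  "laplacian T d n = (\<chi> i j.
     if i = j then - (\<Sum>k\<in>{k. {i, k} \<in> simplices T 1}. dual_volume T d n {i, k} / edge_length d i k)
     else if {i, j} \<in> simplices T 1 then dual_volume T d n {i, j} / edge_length d i j
     else 0)"

definition negative_semidefinite :: "real^'v^'v::finite \<Rightarrow> bool" where
  "negative_semidefinite A \<longleftrightarrow> transpose A = A \<and> (\<forall>x. x \<bullet> (A *v x) \<le> 0)"

end

theory Submission
  imports Defs
begin

text \<open>With the edge weights \<open>w\<close> the Laplacian satisfies
  \<open>- 2 (x \<bullet> L x) = (\<Sum>i j. w i j (x i - x j)\<^sup>2)\<close>, so a vector of the nullspace agrees on the endpoints of
  every edge, hence on the vertices of every simplex. Its linear extension to the geometric
  realization is then constant on each simplex. Being continuous with finitely many values on a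
  connected space, it is constant.\<close>

text \<open>Extension by 0 to all pairs, so that sums over neighbours become sums over
  \<open>UNIV\<close>. The diagonal is 0 as well, because \<open>{i, i}\<close> has one element and
  is no 1-simplex.\<close>

definition dual_weight :: "'v::finite set set \<Rightarrow> ('v \<Rightarrow> 'v \<Rightarrow> real) \<Rightarrow> nat \<Rightarrow> 'v \<Rightarrow> 'v \<Rightarrow> real" where
  "dual_weight T d n i j =
     (if {i, j} \<in> simplices T 1 then dual_volume T d n {i, j} / edge_length d i j else 0)"

lemma dual_weight_commute: "dual_weight T d n i j = dual_weight T d n j i"
  by (simp add: dual_weight_def edge_length_def insert_commute add.commute)

lemma laplacian_nth:
  "laplacian T d n $ i $ j =
     dual_weight T d n i j - (if i = j then \<Sum>k\<in>UNIV. dual_weight T d n i k else 0)"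
proof -
  have "(\<Sum>k\<in>{k. {i, k} \<in> simplices T 1}. dual_volume T d n {i, k} / edge_length d i k)
      = (\<Sum>k\<in>UNIV. dual_weight T d n i k)"
    unfolding dual_weight_def by (simp only: sum.If_cases[OF finite]) simp
  moreover have "dual_weight T d n i i = 0"
    by (simp add: dual_weight_def simplices_def)
  ultimately show ?thesis
    by (cases "i = j") (simp_all add: laplacian_def dual_weight_def)
qed

lemma transpose_laplacian: "transpose (laplacian T d n) = laplacian T d n"
  by (simp add: transpose_def vec_eq_iff laplacian_nth dual_weight_commute)

text \<open>The row sum on the diagonal turns the product into differences, which makes it evident
  that constant vectors are mapped to 0.\<close>

lemma laplacian_mult_nth:
  "(laplacian T d n *v x) $ i = (\<Sum>j\<in>UNIV. dual_weight T d n i j * (x $ j - x $ i))"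
  by (simp add: matrix_vector_mult_def laplacian_nth left_diff_distrib right_diff_distrib
      sum_subtractf sum_distrib_right if_distrib[of "\<lambda>t. t * _"] cong: if_cong)

text \<open>Symmetry of the weights allows exchanging \<open>i\<close> and \<open>j\<close>. The two
  forms of the sum combine by \<open>a * (b - a) + b * (a - b) = - (a - b)\<^sup>2\<close>. Each
  edge is counted in both directions, hence the factor 2.\<close>

lemma laplacian_quadratic_form:
  "2 * (x \<bullet> (laplacian T d n *v x)) =
     - (\<Sum>i\<in>UNIV. \<Sum>j\<in>UNIV. dual_weight T d n i j * (x $ i - x $ j)\<^sup>2)"
proof -
  let ?w = "dual_weight T d n"
  have q: "x \<bullet> (laplacian T d n *v x) = (\<Sum>i\<in>UNIV. \<Sum>j\<in>UNIV. ?w i j * (x $ i * (x $ j - x $ i)))"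
    by (simp add: inner_vec_def laplacian_mult_nth sum_distrib_left mult.left_commute)
  also have "\<dots> = (\<Sum>i\<in>UNIV. \<Sum>j\<in>UNIV. ?w j i * (x $ j * (x $ i - x $ j)))"
    by (rule sum.swap)
  also have "\<dots> = (\<Sum>i\<in>UNIV. \<Sum>j\<in>UNIV. ?w i j * (x $ j * (x $ i - x $ j)))"
    by (simp add: dual_weight_commute)
  finally have "2 * (x \<bullet> (laplacian T d n *v x)) =
      (\<Sum>i\<in>UNIV. \<Sum>j\<in>UNIV. ?w i j * (x $ i * (x $ j - x $ i)) + ?w i j * (x $ j * (x $ i - x $ j)))"
    using q by (simp add: sum.distrib)
  also have "\<dots> = (\<Sum>i\<in>UNIV. \<Sum>j\<in>UNIV. - (?w i j * (x $ i - x $ j)\<^sup>2))"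
    by (intro sum.cong refl) (simp add: algebra_simps power2_eq_square)
  finally show ?thesis by (simp add: sum_negf)
qed

lemma eq_vertices_if_eq_on_edges:
  fixes x :: "real^'v::finite"
  assumes T: "abstract_complex T" "\<Union>T = UNIV"
    and conn: "connected (geometric_realization T)"
    and edge: "\<And>i j. {i, j} \<in> simplices T 1 \<Longrightarrow> x $ i = x $ j"
  shows "x $ a = x $ b"
proof -
  \<comment> \<open>\<open>?f\<close> is the linear extension of the vertex values:
    \<open>?f (axis i 1) = x $ i\<close>.\<close>
  let ?G = "geometric_realization T" and ?f = "\<lambda>y. y \<bullet> x"
  have vertex: "axis i 1 \<in> ?G" for i
  proof -
    have "i \<in> \<Union>T" by (simp add: T(2))
    then obtain \<sigma> where "\<sigma> \<in> T" "i \<in> \<sigma>" by (rule UnionE)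
    moreover have "axis i 1 \<in> convex hull ((\<lambda>i. axis i 1 :: real^'v) ` \<sigma>)"
      using \<open>i \<in> \<sigma>\<close> by (intro hull_inc imageI)
    ultimately show ?thesis by (auto simp: geometric_realization_def)
  qed
  have "?f y \<in> range (($) x)" if y: "y \<in> ?G" for y
  proof -
    obtain \<sigma> where \<sigma>: "\<sigma> \<in> T" "y \<in> convex hull ((\<lambda>i. axis i 1) ` \<sigma>)"
      using y by (auto simp: geometric_realization_def)
    \<comment> \<open>Simplices are nonempty; the value at any vertex serves as the
      constant.\<close>
    then obtain i where i: "i \<in> \<sigma>"
      using T(1) by (metis abstract_complex_def all_not_in_conv)
    have eq: "x $ j = x $ i" if "j \<in> \<sigma>" for j
    proof (cases "i = j")
      case False
      then have "{j, i} \<in> simplices T 1"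
        using T(1) \<sigma>(1) i that by (auto simp: abstract_complex_def simplices_def)
      then show ?thesis by (rule edge)
    qed simp
    \<comment> \<open>A level set of a linear form is convex, so a value shared by the vertices is
      taken on their whole hull.\<close>
    have "convex hull ((\<lambda>i. axis i 1) ` \<sigma>) \<subseteq> {z. x \<bullet> z = x $ i}"
      by (rule hull_minimal) (auto simp: inner_axis convex_hyperplane intro: eq)
    then show ?thesis using \<sigma>(2) by (auto simp: inner_commute)
  qed
  \<comment> \<open>There are finitely many vertices, so \<open>x\<close> has finitely many
    entries.\<close>
  then have "finite (?f ` ?G)"
    by (intro finite_subset[of "?f ` ?G" "range (($) x)"] image_subsetI) auto
  moreover have "connected (?f ` ?G)"
    by (intro connected_continuous_image conn continuous_intros)
  moreover have "?f (axis a 1) \<in> ?f ` ?G" "?f (axis b 1) \<in> ?f ` ?G"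
    using vertex by blast+
  ultimately have "?f (axis a 1) = ?f (axis b 1)"
    by (metis connected_finite_iff_sing empty_iff singletonD)
  then show ?thesis by (simp add: inner_axis')
qed

theorem theorem34:
  fixes M :: "'m topology" and n :: nat
    and T :: "'v::finite set set" and d :: "'v \<Rightarrow> 'v \<Rightarrow> real"
  assumes "n_manifold n M" and "connected_space M"
    and "triangulates T M" and "\<Union>T = UNIV"
    and "duality_structure T d"
    and "\<And>i j. {i, j} \<in> simplices T 1 \<Longrightarrow> dual_volume T d n {i, j} > 0"
  shows "negative_semidefinite (laplacian T d n) \<and>
         {x. laplacian T d n *v x = 0} = span {(\<chi> i. c) | c. True}"
proof -
  let ?w = "dual_weight T d n" and ?L = "laplacian T d n"
  let ?C = "{(\<chi> i. c) | c. True} :: (real^'v) set"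
  have w_pos: "?w i j > 0" if "{i, j} \<in> simplices T 1" for i j
    using assms(5,6) that by (simp add: dual_weight_def duality_structure_def)
  have w_nonneg: "?w i j \<ge> 0" for i j
  proof (cases "{i, j} \<in> simplices T 1")
    case True
    then show ?thesis using w_pos less_imp_le by blast
  next
    case False
    then show ?thesis by (simp add: dual_weight_def)
  qed
  have terms: "0 \<le> ?w i j * (x $ i - x $ j)\<^sup>2" for x i j
    using w_nonneg by simp
  have complex: "abstract_complex T"
    and "top_of_set (geometric_realization T) homeomorphic_space M"
    using assms(3) by (simp_all add: triangulates_def)
  then have "connected_space (top_of_set (geometric_realization T))"
    using assms(2) homeomorphic_connected_space by blast
  then have conn: "connected (geometric_realization T)"
    by (simp add: connectedin_def flip: connectedin_iff_connected)
  have sum_terms: "0 \<le> (\<Sum>i\<in>UNIV. \<Sum>j\<in>UNIV. ?w i j * (x $ i - x $ j)\<^sup>2)" for x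
    by (intro sum_nonneg terms)
  have "x \<bullet> (?L *v x) \<le> 0" for x
    using laplacian_quadratic_form[of x T d n] sum_terms[of x] by linarith
  then have "negative_semidefinite ?L"
    by (simp add: negative_semidefinite_def transpose_laplacian)
  moreover have "{x. ?L *v x = 0} = ?C"
  proof (intro equalityI subsetI)
    fix x assume "x \<in> {x. ?L *v x = 0}"
    then have "(\<Sum>i\<in>UNIV. \<Sum>j\<in>UNIV. ?w i j * (x $ i - x $ j)\<^sup>2) = 0"
      using laplacian_quadratic_form[of x T d n] by simp
    \<comment> \<open>A vanishing sum of nonnegative terms has only zero terms.\<close>
    then have "?w i j * (x $ i - x $ j)\<^sup>2 = 0" for i j
      by (simp add: sum_nonneg_eq_0_iff sum_nonneg terms del: mult_eq_0_iff)
    then have "x $ i = x $ j" if "{i, j} \<in> simplices T 1" for i j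
      using w_pos[OF that] by (metis eq_iff_diff_eq_0 less_irrefl mult_eq_0_iff power_eq_0_iff)
    then have "x $ i = x $ j" for i j
      by (rule eq_vertices_if_eq_on_edges[OF complex assms(4) conn])
    \<comment> \<open>All entries agree, so the one at an arbitrary vertex \<open>undefined\<close>
      gives the constant.\<close>
    then have "x = (\<chi> i. x $ undefined)" by (simp add: vec_eq_iff)
    then show "x \<in> ?C" by blast
  qed (auto simp: vec_eq_iff laplacian_mult_nth)
  \<comment> \<open>The constant vectors already form a subspace, so comparing the nullspace with
    \<open>?C\<close> itself was enough.\<close>
  moreover have "span ?C = ?C"
    unfolding span_eq_iff subspace_def by (auto simp: vec_eq_iff)
  ultimately show ?thesis by (simp only:)
qed

end
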